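(* Let $(N,\tau,h)$ be a pseudocontraction over a commutative ring $R$ with unit, let $d$ be the differential of $N$, and let $\partial$ be a perturbation of $d$. Let $t=\mathrm{Id}_N-\tau$. Suppose that the degree zero endomorphisms $\mathrm{Id}_N+h\partial$ and $\mathrm{Id}_N+\partial h$ of $N$ are invertible (that is, that the $\mathcal A$-module structure on $N$ determined by the pseudocontraction structure and $\partial$ extends to an $\widehat{\mathcal A}$-module structure on $N$). Let $\alpha=(\mathrm{Id}_N+h\partial)^{-1}$, $\beta=(\mathrm{Id}_N+\partial h)^{-1}$, $t_\partial=\alpha t\beta$, $h_\partial=\alpha h=h\beta$, and let $N_\partial$ denote the chain complex $(N,d+\partial)$. Then $(N_\partial,\mathrm{Id}_N-t_\partial,h_\partial)$ is a pseudocontraction as well.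
   Context: Chain complexes are over $R$, with differential of degree $-1$. A pseudocontraction $(N,\tau,h)$ consists of a chain complex $N$ with differential $d$, a chain endomorphism $\tau\colon N\to N$, and a homogeneous degree $1$ operator $h\colon N\to N$ such that $dh+hd=\tau$ and $h^2=0$. A perturbation $\partial$ of the differential $d$ on $N$ is a homogeneous degree $-1$ operator $\partial$ on $N$ such that $d+\partial$ has square zero. The algebra $\mathcal A=\mathcal P*\mathcal H$ is the free product of augmented differential graded $R$-algebras, where $\mathcal H$ is generated by $s$ (degree $1$) and $\tau$ (degree $0$) subject to $Ds=\tau$, $s^2=0$, and $\mathcal P$ has a single generator $x$ of degree $-1$ subject to $Dx+x^2=0$. $\widehat{\mathcal A}$ arises from $\mathcal A$ by formally inverting $1+sx$ and $1+xs$. A pseudocontraction with a perturbation $\partial$ is the same as a differential graded $\mathcal A$-module structure on $N$, with $s$ acting as $h$, $\tau$ as $\tau$, and $x$ as $\partial$. *)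

theory Defs
  imports "HOL-Algebra.Module"
begin

text \<open>
  A \<open>\<int>\<close>-graded module is a family \<open>N i\<close> of modules; an operator of degree \<open>k\<close> is a family of
  linear maps \<open>N i \<rightarrow> N (i + k)\<close>. Values of the component maps outside the carriers are
  irrelevant, so operators are compared by \<open>op_eq\<close> and not by HOL equality.
  The degree is not stored in an operator and is passed explicitly where it is needed.
\<close>

type_synonym 'm gr_op = "int \<Rightarrow> 'm \<Rightarrow> 'm"

definition linear_maps ::
  "('r, 'a) ring_scheme \<Rightarrow> ('r, 'm, 'b) module_scheme \<Rightarrow> ('r, 'm, 'b) module_scheme \<Rightarrow> ('m \<Rightarrow> 'm) set"
  where "linear_maps R M M' =
    {f \<in> hom (add_monoid M) (add_monoid M').
      \<forall>a\<in>carrier R. \<forall>x\<in>carrier M. f (a \<odot>\<^bsub>M\<^esub> x) = a \<odot>\<^bsub>M'\<^esub> f x}"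

definition graded_module ::
  "('r, 'a) ring_scheme \<Rightarrow> (int \<Rightarrow> ('r, 'm, 'b) module_scheme) \<Rightarrow> bool"
  where "graded_module R N \<longleftrightarrow> (\<forall>i. module R (N i))"

definition homogeneous ::
  "('r, 'a) ring_scheme \<Rightarrow> (int \<Rightarrow> ('r, 'm, 'b) module_scheme) \<Rightarrow> int \<Rightarrow> 'm gr_op \<Rightarrow> bool"
  where "homogeneous R N k f \<longleftrightarrow> (\<forall>i. f i \<in> linear_maps R (N i) (N (i + k)))"

definition op_eq ::
  "(int \<Rightarrow> ('r, 'm, 'b) module_scheme) \<Rightarrow> 'm gr_op \<Rightarrow> 'm gr_op \<Rightarrow> bool"
  where "op_eq N f g \<longleftrightarrow> (\<forall>i. \<forall>x\<in>carrier (N i). f i x = g i x)"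

definition op_id :: "'m gr_op"
  where "op_id = (\<lambda>i x. x)"

definition op_zero :: "(int \<Rightarrow> ('r, 'm, 'b) module_scheme) \<Rightarrow> int \<Rightarrow> 'm gr_op"
  where "op_zero N k = (\<lambda>i x. \<zero>\<^bsub>N (i + k)\<^esub>)"

definition op_add ::
  "(int \<Rightarrow> ('r, 'm, 'b) module_scheme) \<Rightarrow> int \<Rightarrow> 'm gr_op \<Rightarrow> 'm gr_op \<Rightarrow> 'm gr_op"
  where "op_add N k f g = (\<lambda>i x. f i x \<oplus>\<^bsub>N (i + k)\<^esub> g i x)"

definition op_diff ::
  "(int \<Rightarrow> ('r, 'm, 'b) module_scheme) \<Rightarrow> int \<Rightarrow> 'm gr_op \<Rightarrow> 'm gr_op \<Rightarrow> 'm gr_op"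
  where "op_diff N k f g = (\<lambda>i x. f i x \<ominus>\<^bsub>N (i + k)\<^esub> g i x)"

text \<open>\<open>op_comp k g f\<close> is the composite \<open>g f\<close> (first \<open>f\<close>, then \<open>g\<close>), where \<open>k\<close> is the degree of \<open>f\<close>.\<close>

definition op_comp :: "int \<Rightarrow> 'm gr_op \<Rightarrow> 'm gr_op \<Rightarrow> 'm gr_op"
  where "op_comp k g f = (\<lambda>i x. g (i + k) (f i x))"

definition op_invertible ::
  "('r, 'a) ring_scheme \<Rightarrow> (int \<Rightarrow> ('r, 'm, 'b) module_scheme) \<Rightarrow> 'm gr_op \<Rightarrow> bool"
  where "op_invertible R N f \<longleftrightarrow> homogeneous R N 0 f \<and>
    (\<exists>g. homogeneous R N 0 g \<and>
      op_eq N (op_comp 0 f g) op_id \<and> op_eq N (op_comp 0 g f) op_id)"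

definition op_inverse ::
  "(int \<Rightarrow> ('r, 'm, 'b) module_scheme) \<Rightarrow> 'm gr_op \<Rightarrow> 'm gr_op"
  where "op_inverse N f = (\<lambda>i. inv_into (carrier (N i)) (f i))"

definition chain_complex ::
  "('r, 'a) ring_scheme \<Rightarrow> (int \<Rightarrow> ('r, 'm, 'b) module_scheme) \<Rightarrow> 'm gr_op \<Rightarrow> bool"
  where "chain_complex R N d \<longleftrightarrow>
    graded_module R N \<and> homogeneous R N (-1) d \<and>
    op_eq N (op_comp (-1) d d) (op_zero N (-2))"

definition chain_endomorphism ::
  "('r, 'a) ring_scheme \<Rightarrow> (int \<Rightarrow> ('r, 'm, 'b) module_scheme) \<Rightarrow> 'm gr_op \<Rightarrow> 'm gr_op \<Rightarrow> bool"
  where "chain_endomorphism R N d \<tau> \<longleftrightarrow>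
    homogeneous R N 0 \<tau> \<and> op_eq N (op_comp 0 d \<tau>) (op_comp (-1) \<tau> d)"

definition pseudocontraction ::
  "('r, 'a) ring_scheme \<Rightarrow> (int \<Rightarrow> ('r, 'm, 'b) module_scheme) \<Rightarrow> 'm gr_op \<Rightarrow> 'm gr_op \<Rightarrow> 'm gr_op \<Rightarrow> bool"
  where "pseudocontraction R N d \<tau> h \<longleftrightarrow>
    chain_complex R N d \<and> chain_endomorphism R N d \<tau> \<and> homogeneous R N 1 h \<and>
    op_eq N (op_add N 0 (op_comp 1 d h) (op_comp (-1) h d)) \<tau> \<and>
    op_eq N (op_comp 1 h h) (op_zero N 2)"

definition perturbation ::
  "('r, 'a) ring_scheme \<Rightarrow> (int \<Rightarrow> ('r, 'm, 'b) module_scheme) \<Rightarrow> 'm gr_op \<Rightarrow> 'm gr_op \<Rightarrow> bool"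
  where "perturbation R N d \<delta> \<longleftrightarrow>
    homogeneous R N (-1) \<delta> \<and>
    op_eq N (op_comp (-1) (op_add N (-1) d \<delta>) (op_add N (-1) d \<delta>)) (op_zero N (-2))"

end

theory Submission
  imports Defs
begin

text \<open>
  Put \<open>A = 1 + h \<delta>\<close>, \<open>B = 1 + \<delta> h\<close> and \<open>D = d + \<delta>\<close>. From \<open>A h = h B\<close> one gets
  \<open>h\<^sub>\<delta> = \<alpha> h = h \<beta>\<close>, hence \<open>h\<^sub>\<delta> h\<^sub>\<delta> = \<alpha> h h \<beta> = 0\<close>. Multiplying the homotopy identity
  \<open>D h\<^sub>\<delta> + h\<^sub>\<delta> D = 1 - \<alpha> t \<beta>\<close> by \<open>A\<close> on the left and \<open>B\<close> on the right turns it into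
  \<open>A D h + h D B = A B - t\<close>, which is inverse-free and follows from
  \<open>\<delta> D + D \<delta> = \<delta> \<delta>\<close>, a consequence of \<open>d d = D D = 0\<close>.
  A map of the form \<open>D h\<^sub>\<delta> + h\<^sub>\<delta> D\<close> automatically commutes with \<open>D\<close>.
\<close>

section \<open>Linear maps between two modules\<close>

lemma linear_mapsD:
  assumes "module R M" "module R M'" "f \<in> linear_maps R M M'"
  shows linear_maps_closed: "x \<in> carrier M \<Longrightarrow> f x \<in> carrier M'"
    and linear_maps_add: "x \<in> carrier M \<Longrightarrow> y \<in> carrier M \<Longrightarrow> f (x \<oplus>\<^bsub>M\<^esub> y) = f x \<oplus>\<^bsub>M'\<^esub> f y"
    and linear_maps_smult: "a \<in> carrier R \<Longrightarrow> x \<in> carrier M \<Longrightarrow> f (a \<odot>\<^bsub>M\<^esub> x) = a \<odot>\<^bsub>M'\<^esub> f x"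
    and linear_maps_zero: "f \<zero>\<^bsub>M\<^esub> = \<zero>\<^bsub>M'\<^esub>"
proof -
  interpret M: module R M by fact
  interpret M': module R M' by fact
  have f: "f \<in> hom (add_monoid M) (add_monoid M')"
    using assms(3) by (simp add: linear_maps_def)
  show "x \<in> carrier M \<Longrightarrow> f x \<in> carrier M'"
    using f by (auto simp: hom_def)
  show "x \<in> carrier M \<Longrightarrow> y \<in> carrier M \<Longrightarrow> f (x \<oplus>\<^bsub>M\<^esub> y) = f x \<oplus>\<^bsub>M'\<^esub> f y"
    using f by (auto simp: hom_def)
  show "a \<in> carrier R \<Longrightarrow> x \<in> carrier M \<Longrightarrow> f (a \<odot>\<^bsub>M\<^esub> x) = a \<odot>\<^bsub>M'\<^esub> f x"
    using assms(3) by (simp add: linear_maps_def)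
  show "f \<zero>\<^bsub>M\<^esub> = \<zero>\<^bsub>M'\<^esub>"
    using hom_one[OF f M.a_group M'.a_group] by simp
qed

lemma linear_mapsI:
  assumes "\<And>x. x \<in> carrier M \<Longrightarrow> f x \<in> carrier M'"
    and "\<And>x y. x \<in> carrier M \<Longrightarrow> y \<in> carrier M \<Longrightarrow> f (x \<oplus>\<^bsub>M\<^esub> y) = f x \<oplus>\<^bsub>M'\<^esub> f y"
    and "\<And>a x. a \<in> carrier R \<Longrightarrow> x \<in> carrier M \<Longrightarrow> f (a \<odot>\<^bsub>M\<^esub> x) = a \<odot>\<^bsub>M'\<^esub> f x"
  shows "f \<in> linear_maps R M M'"
  using assms by (auto simp: linear_maps_def hom_def)

section \<open>Graded modules and homogeneous operators on them\<close>

locale graded_module_over =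
  fixes R :: "('r, 'a) ring_scheme"
    and N :: "int \<Rightarrow> ('r, 'm, 'b) module_scheme"
  assumes graded: "graded_module R N"
begin

lemma module_component: "module R (N i)"
  using graded by (simp add: graded_module_def)

sublocale comp: module R "N i" for i
  by (rule module_component)

context
  fixes k f
  assumes f: "homogeneous R N k f"
begin

lemma homogeneous_component: "f i \<in> linear_maps R (N i) (N (i + k))"
  using f by (simp add: homogeneous_def)

lemmas homogeneous_closed =
    linear_maps_closed[OF module_component module_component homogeneous_component]
  and homogeneous_add =
    linear_maps_add[OF module_component module_component homogeneous_component]
  and homogeneous_smult =
    linear_maps_smult[OF module_component module_component homogeneous_component]
  and homogeneous_zero =
    linear_maps_zero[OF module_component module_component homogeneous_component]

end

lemma homogeneous_op_id: "homogeneous R N 0 op_id"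
  by (auto simp: homogeneous_def op_id_def intro!: linear_mapsI)

lemma homogeneous_op_comp:
  assumes "homogeneous R N j f" "homogeneous R N k g"
  shows "homogeneous R N (j + k) (op_comp j g f)"
  \<comment> \<open>Reassociating turns the target index \<open>i + (j + k)\<close> into
    \<open>(i + j) + k\<close>, the index at which \<open>g\<close> delivers its values.\<close>
  unfolding homogeneous_def op_comp_def add.assoc[symmetric]
  by (auto intro!: linear_mapsI simp: homogeneous_closed[OF assms(1)] homogeneous_closed[OF assms(2)]
      homogeneous_add[OF assms(1)] homogeneous_add[OF assms(2)]
      homogeneous_smult[OF assms(1)] homogeneous_smult[OF assms(2)])

lemma homogeneous_op_add:
  assumes "homogeneous R N k f" "homogeneous R N k g"
  shows "homogeneous R N k (op_add N k f g)"
  unfolding homogeneous_def op_add_def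
  by (auto intro!: linear_mapsI simp: homogeneous_closed[OF assms(1)] homogeneous_closed[OF assms(2)]
      homogeneous_add[OF assms(1)] homogeneous_add[OF assms(2)] comp.a_ac comp.smult_r_distr
      homogeneous_smult[OF assms(1)] homogeneous_smult[OF assms(2)])

lemma homogeneous_op_diff:
  assumes "homogeneous R N k f" "homogeneous R N k g"
  shows "homogeneous R N k (op_diff N k f g)"
  unfolding homogeneous_def op_diff_def a_minus_def
  by (auto intro!: linear_mapsI simp: homogeneous_closed[OF assms(1)] homogeneous_closed[OF assms(2)]
      homogeneous_add[OF assms(1)] homogeneous_add[OF assms(2)] comp.a_ac comp.smult_r_distr
      homogeneous_smult[OF assms(1)] homogeneous_smult[OF assms(2)] comp.minus_add comp.smult_r_minus)

section \<open>Inverses of invertible operators of degree zero\<close>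

context
  fixes f
  assumes inv: "op_invertible R N f"
begin

lemma op_invertible_homogeneous: "homogeneous R N 0 f"
  using inv by (simp add: op_invertible_def)

text \<open>The witness \<open>g\<close> maps carriers to carriers and undoes \<open>f\<close> on
  both sides. This makes the \<open>inv_into\<close> behind \<open>op_inverse\<close> a genuine
  two-sided inverse on each component.\<close>

lemma op_invertible_bij: "bij_betw (f i) (carrier (N i)) (carrier (N i))"
proof -
  obtain g where g: "homogeneous R N 0 g" "op_eq N (op_comp 0 f g) op_id"
    "op_eq N (op_comp 0 g f) op_id"
    using inv by (auto simp: op_invertible_def)
  show ?thesis
    using g homogeneous_closed[OF op_invertible_homogeneous, of _ i] homogeneous_closed[OF g(1), of _ i]
    by (intro bij_betw_byWitness[where f' = "g i"]) (auto simp: op_eq_def op_comp_def op_id_def)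
qed

lemma op_inverse_right: "x \<in> carrier (N i) \<Longrightarrow> f i (op_inverse N f i x) = x"
  using bij_betw_inv_into_right[OF op_invertible_bij] by (simp add: op_inverse_def)

lemma op_inverse_left: "x \<in> carrier (N i) \<Longrightarrow> op_inverse N f i (f i x) = x"
  using bij_betw_inv_into_left[OF op_invertible_bij] by (simp add: op_inverse_def)

lemma homogeneous_op_inverse: "homogeneous R N 0 (op_inverse N f)"
proof -
  have closed: "op_inverse N f i x \<in> carrier (N i)" if "x \<in> carrier (N i)" for i x
    using bij_betw_apply[OF bij_betw_inv_into[OF op_invertible_bij] that] by (simp add: op_inverse_def)
  \<comment> \<open>A function obtained from \<open>inv_into\<close> is not linear by construction.
    As \<open>f\<close> is injective on carriers, exhibiting a preimage determines the value of the
    inverse, so linearity is inherited from \<open>f\<close>.\<close>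
  have eqI: "op_inverse N f i x = y" if "y \<in> carrier (N i)" "f i y = x" for i x y
    using op_inverse_left[OF that(1)] that(2) by simp
  show ?thesis
    unfolding homogeneous_def
    using homogeneous_add[OF op_invertible_homogeneous] homogeneous_smult[OF op_invertible_homogeneous]
    by (auto intro!: linear_mapsI eqI simp: closed op_inverse_right)
qed

end

text \<open>Because \<open>d d = 0\<close>, both \<open>d (d h + h d)\<close> and
  \<open>(d h + h d) d\<close> reduce to \<open>d h d\<close>. Hence \<tau> is a chain map as soon
  as it has degree zero and satisfies the homotopy identity.\<close>

lemma pseudocontractionI:
  assumes "chain_complex R N d" "homogeneous R N 0 \<tau>" "homogeneous R N 1 h"
    and ht: "op_eq N (op_add N 0 (op_comp 1 d h) (op_comp (-1) h d)) \<tau>"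
    and "op_eq N (op_comp 1 h h) (op_zero N 2)"
  shows "pseudocontraction R N d \<tau> h"
proof -
  have d: "homogeneous R N (-1) d" and dd: "\<And>i x. x \<in> carrier (N i) \<Longrightarrow> d (i - 1) (d i x) = \<zero>\<^bsub>N (i - 2)\<^esub>"
    using assms(1) by (auto simp: chain_complex_def op_eq_def op_comp_def op_zero_def)
  note cl = homogeneous_closed[OF d, simplified] homogeneous_closed[OF assms(3)]
  have hd: "\<tau> i x = d (i + 1) (h i x) \<oplus>\<^bsub>N i\<^esub> h (i - 1) (d i x)" if "x \<in> carrier (N i)" for i x
    using ht that by (simp add: op_eq_def op_add_def op_comp_def)
  have "d i (\<tau> i x) = \<tau> (i - 1) (d i x)" if x: "x \<in> carrier (N i)" for i x
  proof -
    have 1: "d (i + 1) (h i x) \<in> carrier (N i)" "h (i - 1) (d i x) \<in> carrier (N i)"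
      using x cl(1)[of "h i x" "i + 1"] cl(1)[of x i] cl(2)[of x i] cl(2)[of "d i x" "i - 1"] by simp_all
    have 2: "d i (d (i + 1) (h i x)) = \<zero>\<^bsub>N (i - 1)\<^esub>"
      using dd[of "h i x" "i + 1"] cl(2)[OF x] by simp
    have 3: "h (i - 2) (d (i - 1) (d i x)) = \<zero>\<^bsub>N (i - 1)\<^esub>"
      using dd[OF x] homogeneous_zero[OF assms(3), of "i - 2"] by simp
    have 4: "d i (h (i - 1) (d i x)) \<in> carrier (N (i - 1))"
      using cl(1)[OF 1(2)] .
    show ?thesis
      using hd[OF x] hd[OF cl(1)[OF x]] homogeneous_add[OF d 1] 2 3 4 by simp
  qed
  then show ?thesis
    using assms by (simp add: pseudocontraction_def chain_endomorphism_def op_eq_def op_comp_def)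
qed

end

theorem corollary5p1:
  fixes R :: "('r, 'a) ring_scheme"
    and N :: "int \<Rightarrow> ('r, 'm, 'b) module_scheme"
    and d \<tau> h \<delta> t \<alpha> \<beta> t\<^sub>\<delta> h\<^sub>\<delta> :: "'m gr_op"
  assumes "cring R"
    and "pseudocontraction R N d \<tau> h"
    and "perturbation R N d \<delta>"
    and "t = op_diff N 0 op_id \<tau>"
    and "op_invertible R N (op_add N 0 op_id (op_comp (-1) h \<delta>))"
    and "op_invertible R N (op_add N 0 op_id (op_comp 1 \<delta> h))"
    and "\<alpha> = op_inverse N (op_add N 0 op_id (op_comp (-1) h \<delta>))"
    and "\<beta> = op_inverse N (op_add N 0 op_id (op_comp 1 \<delta> h))"
    and "t\<^sub>\<delta> = op_comp 0 \<alpha> (op_comp 0 t \<beta>)"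
    and "h\<^sub>\<delta> = op_comp 1 \<alpha> h"
  shows "op_eq N h\<^sub>\<delta> (op_comp 0 h \<beta>) \<and>
    pseudocontraction R N (op_add N (-1) d \<delta>) (op_diff N 0 op_id t\<^sub>\<delta>) h\<^sub>\<delta>"
proof -
  interpret graded_module_over R N
    using assms(2) by unfold_locales (simp add: pseudocontraction_def chain_complex_def)
  define A where "A = op_add N 0 op_id (op_comp (-1) h \<delta>)"
  define B where "B = op_add N 0 op_id (op_comp 1 \<delta> h)"
  define D where "D = op_add N (-1) d \<delta>"
  have inv: "op_invertible R N A" "op_invertible R N B"
    and \<alpha>_def: "\<alpha> = op_inverse N A" and \<beta>_def: "\<beta> = op_inverse N B"
    using assms(5-8) by (simp_all add: A_def B_def)

  have d: "homogeneous R N (-1) d" and \<tau>: "homogeneous R N 0 \<tau>" and h: "homogeneous R N 1 h"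
    and \<delta>: "homogeneous R N (-1) \<delta>"
    using assms(2,3)
    by (auto simp: pseudocontraction_def chain_complex_def chain_endomorphism_def perturbation_def)
  have D: "homogeneous R N (-1) D"
    unfolding D_def by (rule homogeneous_op_add[OF d \<delta>])
  have t: "homogeneous R N 0 t"
    unfolding assms(4) by (rule homogeneous_op_diff[OF homogeneous_op_id \<tau>])
  note A = op_invertible_homogeneous[OF inv(1)] and B = op_invertible_homogeneous[OF inv(2)]
  have \<alpha>: "homogeneous R N 0 \<alpha>" and \<beta>: "homogeneous R N 0 \<beta>"
    unfolding \<alpha>_def \<beta>_def by (rule homogeneous_op_inverse, fact)+
  have t\<delta>: "homogeneous R N 0 t\<^sub>\<delta>"
    unfolding assms(9)
    using homogeneous_op_comp[OF homogeneous_op_comp[OF \<beta> t] \<alpha>] by simp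
  have h\<delta>: "homogeneous R N 1 h\<^sub>\<delta>"
    unfolding assms(10) using homogeneous_op_comp[OF h \<alpha>] by simp

  note cl0 = homogeneous_closed[OF A, simplified] homogeneous_closed[OF B, simplified]
    homogeneous_closed[OF \<alpha>, simplified] homogeneous_closed[OF \<beta>, simplified]
    homogeneous_closed[OF t, simplified] homogeneous_closed[OF t\<delta>, simplified]
    homogeneous_closed[OF \<tau>, simplified]
  \<comment> \<open>The target index is a separate variable \<open>j\<close> tied to
    \<open>i\<close> by an equation, so that carriers with indices such as \<open>i - 1 + 1\<close>
    and \<open>i\<close> match up to arithmetic.\<close>
  have cl_up: "f i x \<in> carrier (N j)"
    if "homogeneous R N 1 f" "x \<in> carrier (N i)" "j = i + 1" for f i j x
    using homogeneous_closed[OF that(1,2)] that(3) by simp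
  have cl_down: "f i x \<in> carrier (N j)"
    if "homogeneous R N (-1) f" "x \<in> carrier (N i)" "j = i - 1" for f i j x
    using homogeneous_closed[OF that(1,2)] that(3) by simp
  note cl = cl0 cl_up[OF h] cl_up[OF h\<delta>] cl_down[OF d] cl_down[OF \<delta>] cl_down[OF D]
  note add0 = homogeneous_add[OF A, simplified]
  have add_h: "h i (x \<oplus>\<^bsub>N i\<^esub> y) = h i x \<oplus>\<^bsub>N (i + 1)\<^esub> h i y"
    if "x \<in> carrier (N i)" "y \<in> carrier (N i)" for i x y
    using homogeneous_add[OF h that] .
  have add_\<delta>: "\<delta> i (x \<oplus>\<^bsub>N i\<^esub> y) = \<delta> i x \<oplus>\<^bsub>N (i - 1)\<^esub> \<delta> i y"
    if "x \<in> carrier (N i)" "y \<in> carrier (N i)" for i x y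
    using homogeneous_add[OF \<delta> that] by simp
  have add_d: "d i (x \<oplus>\<^bsub>N i\<^esub> y) = d i x \<oplus>\<^bsub>N (i - 1)\<^esub> d i y"
    if "x \<in> carrier (N i)" "y \<in> carrier (N i)" for i x y
    using homogeneous_add[OF d that] by simp

  \<comment> \<open>Pointwise form of the hypotheses and of the operators\<close>
  have dd: "d (i - 1) (d i x) = \<zero>\<^bsub>N (i - 2)\<^esub>"
    and hh: "h (i + 1) (h i x) = \<zero>\<^bsub>N (i + 2)\<^esub>"
    and dh: "d (i + 1) (h i x) \<oplus>\<^bsub>N i\<^esub> h (i - 1) (d i x) = \<tau> i x"
    if "x \<in> carrier (N i)" for i x
    using assms(2) that
    by (auto simp: pseudocontraction_def chain_complex_def op_eq_def op_comp_def op_zero_def op_add_def)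
  have DD: "op_eq N (op_comp (-1) D D) (op_zero N (-2))"
    using assms(3) by (simp add: perturbation_def D_def)
  have A_eq: "A i x = x \<oplus>\<^bsub>N i\<^esub> h (i - 1) (\<delta> i x)"
    and B_eq: "B i x = x \<oplus>\<^bsub>N i\<^esub> \<delta> (i + 1) (h i x)"
    and D_eq: "D i x = d i x \<oplus>\<^bsub>N (i - 1)\<^esub> \<delta> i x"
    and t_eq: "t i x = x \<ominus>\<^bsub>N i\<^esub> \<tau> i x" for i x
    by (simp_all add: A_def B_def D_def assms(4) op_add_def op_diff_def op_comp_def op_id_def)

  \<comment> \<open>Both sides expand to \<open>h + h \<delta> h\<close> applied to
    \<open>y\<close>.\<close>
  have Ah: "A (i + 1) (h i y) = h i (B i y)" if y: "y \<in> carrier (N i)" for i y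
    using y by (simp add: A_eq B_eq add_h cl)
  \<comment> \<open>With \<open>x = B (\<beta> x)\<close> the previous identity gives
    \<open>\<alpha> h x = \<alpha> h B \<beta> x = \<alpha> A h \<beta> x = h \<beta>
    x\<close>.\<close>
  have h\<delta>_eq: "h\<^sub>\<delta> i x = h i (\<beta> i x)" if x: "x \<in> carrier (N i)" for i x
    using op_inverse_left[OF inv(1), of "h i (\<beta> i x)" "i + 1"] Ah[of "\<beta> i x" i]
      op_inverse_right[OF inv(2) x] x cl
    by (simp add: assms(10) op_comp_def flip: \<alpha>_def \<beta>_def)
  have "h\<^sub>\<delta> (i + 1) (h\<^sub>\<delta> i x) = \<zero>\<^bsub>N (i + 2)\<^esub>" if x: "x \<in> carrier (N i)" for i x
  proof -
    have "h\<^sub>\<delta> (i + 1) (h\<^sub>\<delta> i x) = \<alpha> (i + 2) (h (i + 1) (h i (\<beta> i x)))"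
      using h\<delta>_eq[OF x] by (simp add: assms(10) op_comp_def add.commute)
    then show ?thesis
      using hh[of "\<beta> i x" i] x cl homogeneous_zero[OF \<alpha>, of "i + 2"] by simp
  qed
  then have h\<delta>h\<delta>: "op_eq N (op_comp 1 h\<^sub>\<delta> h\<^sub>\<delta>) (op_zero N 2)"
    by (simp add: op_eq_def op_comp_def op_zero_def)

  have \<delta>D: "\<delta> (i - 1) (D i z) \<oplus>\<^bsub>N (i - 2)\<^esub> D (i - 1) (\<delta> i z) = \<delta> (i - 1) (\<delta> i z)"
    if z: "z \<in> carrier (N i)" for i z
  proof -
    \<comment> \<open>In this notation the claim reads \<open>(b + c) + (a + c) = c\<close>. Since
      \<open>d d = 0\<close>, the equation \<open>D D z = 0\<close> says
      \<open>a + b + c = 0\<close>, and adding \<open>c\<close> to it gives the claim.\<close>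
    define a b c where "a = d (i - 1) (\<delta> i z)" and "b = \<delta> (i - 1) (d i z)"
      and "c = \<delta> (i - 1) (\<delta> i z)"
    have abc: "a \<in> carrier (N (i - 2))" "b \<in> carrier (N (i - 2))" "c \<in> carrier (N (i - 2))"
      using z by (simp_all add: a_def b_def c_def cl)
    have "D (i - 1) (D i z) = \<zero>\<^bsub>N (i - 2)\<^esub>"
      using DD z by (simp add: op_eq_def op_comp_def op_zero_def)
    moreover have "D (i - 1) (D i z) = a \<oplus>\<^bsub>N (i - 2)\<^esub> (b \<oplus>\<^bsub>N (i - 2)\<^esub> c)"
      using z abc dd[OF z] by (simp add: D_eq add_d add_\<delta> cl a_def b_def c_def)
    ultimately have "(a \<oplus>\<^bsub>N (i - 2)\<^esub> (b \<oplus>\<^bsub>N (i - 2)\<^esub> c)) \<oplus>\<^bsub>N (i - 2)\<^esub> c = c"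
      using abc by simp
    moreover have "\<delta> (i - 1) (D i z) = b \<oplus>\<^bsub>N (i - 2)\<^esub> c" "D (i - 1) (\<delta> i z) = a \<oplus>\<^bsub>N (i - 2)\<^esub> c"
      using z by (simp_all add: D_eq add_\<delta> cl a_def b_def c_def)
    ultimately show ?thesis
      using abc by (simp add: comp.a_ac flip: c_def)
  qed

  \<comment> \<open>The perturbed homotopy identity\<close>
  have "D (i + 1) (h\<^sub>\<delta> i x) \<oplus>\<^bsub>N i\<^esub> h\<^sub>\<delta> (i - 1) (D i x) = x \<ominus>\<^bsub>N i\<^esub> t\<^sub>\<delta> i x"
    if x: "x \<in> carrier (N i)" for i x
  proof -
    \<comment> \<open>Multiplication by \<open>B\<close> on the right becomes the substitution
      \<open>x = B y\<close>. Then \<open>z\<close> equals \<open>h\<^sub>\<delta> x\<close>, and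
      \<open>u\<close> below is the left-hand side of the identity.\<close>
    define y where "y = \<beta> i x"
    define z where "z = h i y"
    have y: "y \<in> carrier (N i)" and z: "z \<in> carrier (N (i + 1))"
      using x by (simp_all add: y_def z_def cl)
    have xy: "x = y \<oplus>\<^bsub>N i\<^esub> \<delta> (i + 1) z"
      using op_inverse_right[OF inv(2) x] by (simp add: y_def z_def B_eq \<beta>_def)
    define u where "u = D (i + 1) z \<oplus>\<^bsub>N i\<^esub> h\<^sub>\<delta> (i - 1) (D i x)"
    define p q r s where "p = d (i + 1) z" and "q = \<delta> (i + 1) z" and "r = h (i - 1) (d i y)"
      and "s = h (i - 1) (\<delta> i y)"
    define w v where "w = h (i - 1) (\<delta> i (\<delta> (i + 1) z))" and "v = \<tau> i y"
    \<comment> \<open>Only \<open>D y\<close> is expanded; \<open>D (\<delta> z)\<close> stays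
      intact so that it can later be paired with \<open>\<delta> (D z)\<close>.\<close>
    have Dx: "D i x = d i y \<oplus>\<^bsub>N (i - 1)\<^esub> \<delta> i y \<oplus>\<^bsub>N (i - 1)\<^esub> D i (\<delta> (i + 1) z)"
      using y z by (simp add: xy D_eq add_d add_\<delta> cl comp.a_ac)
    have c: "p \<in> carrier (N i)" "q \<in> carrier (N i)" "r \<in> carrier (N i)" "s \<in> carrier (N i)"
      "w \<in> carrier (N i)" "v \<in> carrier (N i)"
      using y z by (simp_all add: p_def q_def r_def s_def w_def v_def cl)
    have u: "u \<in> carrier (N i)" "t\<^sub>\<delta> i x \<in> carrier (N i)" "t i y \<in> carrier (N i)"
      using x y z by (simp_all add: u_def cl)
    have hD: "A i (h\<^sub>\<delta> (i - 1) (D i x)) = h (i - 1) (D i x)"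
      using op_inverse_right[OF inv(1), of "h (i - 1) (D i x)" i] x
      by (simp add: assms(10) op_comp_def cl flip: \<alpha>_def)
    have At: "A i (t\<^sub>\<delta> i x) = t i y"
      using op_inverse_right[OF inv(1) u(3)] by (simp add: assms(9) op_comp_def y_def flip: \<alpha>_def)
    \<comment> \<open>The first term comes from \<open>A D z\<close>, the second from
      \<open>h D x\<close>. The identity for \<open>\<delta> D + D \<delta>\<close> at
      \<open>z\<close> merges them into \<open>h \<delta> \<delta> z\<close>.\<close>
    have "h (i - 1) (\<delta> i (D (i + 1) z)) \<oplus>\<^bsub>N i\<^esub> h (i - 1) (D i (\<delta> (i + 1) z)) = w"
      using \<delta>D[OF z] add_h[of "\<delta> i (D (i + 1) z)" "i - 1" "D i (\<delta> (i + 1) z)"] z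
      by (simp add: w_def cl)
    moreover have "A i u = p \<oplus>\<^bsub>N i\<^esub> q \<oplus>\<^bsub>N i\<^esub> r \<oplus>\<^bsub>N i\<^esub> s \<oplus>\<^bsub>N i\<^esub>
        (h (i - 1) (\<delta> i (D (i + 1) z)) \<oplus>\<^bsub>N i\<^esub> h (i - 1) (D i (\<delta> (i + 1) z)))"
    proof -
      have "A i u = A i (D (i + 1) z) \<oplus>\<^bsub>N i\<^esub> h (i - 1) (D i x)"
        using x z by (simp add: u_def add0 cl hD)
      also have "A i (D (i + 1) z) = p \<oplus>\<^bsub>N i\<^esub> q \<oplus>\<^bsub>N i\<^esub> h (i - 1) (\<delta> i (D (i + 1) z))"
        by (simp add: A_eq p_def q_def D_eq)
      also have "h (i - 1) (D i x) = r \<oplus>\<^bsub>N i\<^esub> s \<oplus>\<^bsub>N i\<^esub> h (i - 1) (D i (\<delta> (i + 1) z))"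
        using y z add_h[of _ "i - 1"] by (simp add: Dx r_def s_def cl)
      finally show ?thesis
        using c z by (simp add: comp.a_ac cl)
    qed
    ultimately have "A i u = (p \<oplus>\<^bsub>N i\<^esub> r) \<oplus>\<^bsub>N i\<^esub> (q \<oplus>\<^bsub>N i\<^esub> s \<oplus>\<^bsub>N i\<^esub> w)"
      using c by (simp add: comp.a_ac)
    \<comment> \<open>This is the unperturbed identity \<open>d h + h d = \<tau>\<close> at
      \<open>y\<close>.\<close>
    also have "p \<oplus>\<^bsub>N i\<^esub> r = v"
      using dh[OF y] by (simp add: p_def r_def v_def z_def)
    \<comment> \<open>Adding \<open>t y = y - \<tau> y\<close> cancels \<open>v\<close>.\<close>
    finally have "A i u \<oplus>\<^bsub>N i\<^esub> t i y = (v \<oplus>\<^bsub>N i\<^esub> (\<ominus>\<^bsub>N i\<^esub> v)) \<oplus>\<^bsub>N i\<^esub> (y \<oplus>\<^bsub>N i\<^esub> q \<oplus>\<^bsub>N i\<^esub> s \<oplus>\<^bsub>N i\<^esub> w)"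
      using c y by (simp add: t_eq a_minus_def comp.a_ac flip: v_def del: comp.r_neg)
    also have "\<dots> = y \<oplus>\<^bsub>N i\<^esub> q \<oplus>\<^bsub>N i\<^esub> s \<oplus>\<^bsub>N i\<^esub> w"
      using c y by (simp add: comp.r_neg)
    \<comment> \<open>The four remaining terms are the expansion of \<open>A B y\<close>:
      \<open>y\<close>, \<open>\<delta> h y\<close>, \<open>h \<delta> y\<close> and
      \<open>h \<delta> \<delta> h y\<close>.\<close>
    also have "\<dots> = A i x"
      using y z c add_h[of _ "i - 1"] by (simp add: A_eq xy q_def s_def w_def add_\<delta> cl comp.a_ac)
    finally have "A i (u \<oplus>\<^bsub>N i\<^esub> t\<^sub>\<delta> i x) = A i x"
      using u by (simp add: add0 At)
    \<comment> \<open>Injectivity of \<open>A\<close> on the component cancels the left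
      factor.\<close>
    then have "u \<oplus>\<^bsub>N i\<^esub> t\<^sub>\<delta> i x = x"
      using bij_betw_imp_inj_on[OF op_invertible_bij[OF inv(1)], of i] u x
      by (simp add: inj_on_eq_iff)
    moreover have "(u \<oplus>\<^bsub>N i\<^esub> t\<^sub>\<delta> i x) \<ominus>\<^bsub>N i\<^esub> t\<^sub>\<delta> i x = u"
      using u by (simp add: a_minus_def comp.a_assoc comp.r_neg)
    ultimately have "u = x \<ominus>\<^bsub>N i\<^esub> t\<^sub>\<delta> i x"
      by simp
    then show ?thesis
      by (simp add: u_def h\<delta>_eq[OF x] y_def z_def)
  qed
  then have homotopy: "op_eq N (op_add N 0 (op_comp 1 D h\<^sub>\<delta>) (op_comp (-1) h\<^sub>\<delta> D)) (op_diff N 0 op_id t\<^sub>\<delta>)"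
    by (simp add: op_eq_def op_comp_def op_add_def op_diff_def op_id_def)

  have "chain_complex R N D"
    using graded D DD by (simp add: chain_complex_def)
  then have "pseudocontraction R N D (op_diff N 0 op_id t\<^sub>\<delta>) h\<^sub>\<delta>"
    using homogeneous_op_diff[OF homogeneous_op_id t\<delta>] h\<delta> homotopy h\<delta>h\<delta> by (rule pseudocontractionI)
  then show ?thesis
    using h\<delta>_eq by (simp add: op_eq_def op_comp_def D_def)
qed

end
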